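(* A single symbolic orbit can be shared by infinitely many slopes: there exist a word $\omega\in\{a,b\}^{\mathbb{N}}$ and infinitely many slopes $S\in(0,1)$ such that, for each of these slopes $S$, some breakout orbit of slope $S$ has symbolic orbit $\omega$.
   Context: Breakout system. The domain is $\mathbb{R}^2$ and initially all the unit bricks $[x,x+1]\times[y,y+1]$, $(x,y)\in\mathbb{Z}^2\setminus\{(-1,0)\}$, are present. A ball is launched from $(0,y_0)$, for some $0<y_0<1$, in a direction with two positive coordinates and slope $S\in(0,1)$. It moves in a straight line; each time it hits an edge of a brick still present, it is reflected as in a billiard and that brick is destroyed (so at time $0$ the brick $[0,1]\times[0,1]$, brick number $0$, is hit on its left vertical edge and destroyed, and the ball leaves towards decreasing abscissas). Orbits are always assumed not to meet any point of $\mathbb{Z}^2$. The symbolic orbit of a breakout orbit is the right-infinite word $\omega=(\omega_n)_{n\in\mathbb{N}}\in\{a,b\}^{\mathbb{N}}$ such that $\omega_n=a$ if the $n$th destroyed brick (numbered from $0$ in order of destruction) was broken by hitting a horizontal edge, and $\omega_n=b$ otherwise. *)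

theory Defs
  imports "HOL-Analysis.Product_Vector"
begin

type_synonym point = "real \<times> real"

text \<open>The cell \<open>(i, j)\<close> is the place of the unit brick \<open>[i, i + 1] \<times> [j, j + 1]\<close>.\<close>

type_synonym cell = "int \<times> int"

definition horizontal_edges :: "cell \<Rightarrow> point set" where
  "horizontal_edges c =
     {of_int (fst c) .. of_int (fst c) + 1} \<times> {of_int (snd c), of_int (snd c) + 1}"

definition vertical_edges :: "cell \<Rightarrow> point set" where
  "vertical_edges c =
     {of_int (fst c), of_int (fst c) + 1} \<times> {of_int (snd c) .. of_int (snd c) + 1}"

definition edges :: "cell \<Rightarrow> point set" where
  "edges c = horizontal_edges c \<union> vertical_edges c"

text \<open>An impact is the event that the ball, arriving with velocity \<open>incoming\<close>, hits the brick
  \<open>brick\<close> at the point \<open>site\<close> of its boundary. Away from the lattice points, a boundary point of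
  a brick lies either on a horizontal or on a vertical edge, but not on both.\<close>

record impact =
  brick :: cell
  site :: point
  incoming :: point

definition hits_horizontal :: "impact \<Rightarrow> bool" where
  "hits_horizontal e \<longleftrightarrow> site e \<in> horizontal_edges (brick e)"

definition outgoing :: "impact \<Rightarrow> point" where
  "outgoing e =
     (if hits_horizontal e then (fst (incoming e), - snd (incoming e))
      else (- fst (incoming e), snd (incoming e)))"

definition initial_bricks :: "cell set" where
  "initial_bricks = UNIV - {(-1, 0)}"

text \<open>The bricks that are still there once the impacts \<open>0, \<dots>, n\<close> have taken place.\<close>

definition bricks_after :: "(nat \<Rightarrow> impact) \<Rightarrow> nat \<Rightarrow> cell set" where
  "bricks_after h n = initial_bricks - (\<lambda>k. brick (h k)) ` {..n}"

text \<open>A breakout orbit is described by its sequence of impacts. Between impacts \<open>n\<close> and \<open>n + 1\<close>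
  the ball runs along a segment, and impact \<open>n + 1\<close> is the first time at which it
  meets an edge of a remaining brick. Edges that only border empty cells are crossed freely.
  The last clause says that the orbit does not meet the integer lattice.\<close>

definition breakout_orbit :: "real \<Rightarrow> real \<Rightarrow> (nat \<Rightarrow> impact) \<Rightarrow> bool" where
  "breakout_orbit S y\<^sub>0 h \<longleftrightarrow>
     0 < S \<and> S < 1 \<and> 0 < y\<^sub>0 \<and> y\<^sub>0 < 1 \<and>
     h 0 = \<lparr>brick = (0, 0), site = (0, y\<^sub>0), incoming = (1, S)\<rparr> \<and>
     (\<forall>n. incoming (h (Suc n)) = outgoing (h n) \<and>
          brick (h (Suc n)) \<in> bricks_after h n \<and>
          site (h (Suc n)) \<in> edges (brick (h (Suc n))) \<and>
          (\<exists>t>0. site (h (Suc n)) = site (h n) + t *\<^sub>R outgoing (h n) \<and>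
             (\<forall>s. 0 < s \<and> s < t \<longrightarrow>
                (\<forall>c\<in>bricks_after h n. site (h n) + s *\<^sub>R outgoing (h n) \<notin> edges c)) \<and>
             (\<forall>s. 0 \<le> s \<and> s \<le> t \<longrightarrow>
                site (h n) + s *\<^sub>R outgoing (h n) \<notin> \<int> \<times> \<int>)))"

datatype letter = Letter_a | Letter_b

definition symbolic_orbit :: "(nat \<Rightarrow> impact) \<Rightarrow> nat \<Rightarrow> letter" where
  "symbolic_orbit h n = (if hits_horizontal (h n) then Letter_a else Letter_b)"

end

theory Submission
  imports Defs
begin

text \<open>
  All orbits constructed here dig an infinite vertical shaft, one row of bricks after the other, and
  their slopes are close to \<open>1/138\<close>. The velocity is always \<open>(\<plusminus>1, \<plusminus>S)\<close>, so time is the length of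
  the horizontal projection, and the unfolded height \<open>y\<^sub>0 + S X\<close> at time \<open>X\<close> tells when the ball
  reaches a horizontal grid line.

  Suppose the ball enters row \<open>r\<close> from below, through a cell whose two neighbours in the row are
  bricks. It bounces between the two ends of the tunnel that it digs to the left and to the right of
  that cell. Each impact lengthens the tunnel by one cell, so the impacts \<open>j = 0, 1, 2, \<dots>\<close> come at
  the times \<open>j (j + 1) / 2\<close> after the first one, whatever the slope is. (The launch is the first impact
  in row \<open>0\<close>, which is entered through the initial hole.) The ball meets horizontal grid lines a little
  less than \<open>138\<close>, \<open>276\<close> and \<open>414\<close> units after the first impact in the row. Since \<open>138 = T\<^sub>1\<^sub>6 + 2\<close> and
  \<open>414 = T\<^sub>2\<^sub>8 + 8\<close> for the triangular numbers \<open>T\<^sub>j = j (j + 1) / 2\<close>, and since impacts \<open>16\<close> and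
  \<open>28\<close> destroy the bricks at distances \<open>9\<close> and \<open>15\<close> on the same side of the entry, the first and
  the third crossing take place in the same column, namely \<open>9 - 2 = 15 - 8 = 7\<close> cells away from the
  entry. So at the first crossing the ball breaks a roof brick, at the second one it breaks a floor
  brick far to the other side, and at the third one it leaves freely through the hole that it
  made in the roof. Row \<open>r + 1\<close> is then dug in the same way, mirrored. A row contributes \<open>31\<close> letters,
  which are \<open>b\<close> except for two.

  There is some play in this mechanism. If all three crossings of a row come one unit earlier, then
  the roof hole moves by one cell, the first and third crossing still agree, and no impact changes
  its rank. Such an advance by one unit therefore does not affect the symbolic orbit, provided that
  it takes place just before the first crossing of a row. For \<open>1/S = 138 - 1/(3 m)\<close> the crossing times
  lose one unit every \<open>3 m\<close> crossings, that is every \<open>m\<close> rows, and the height \<open>y\<^sub>0\<close> of the launching point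
  is chosen such that the loss always occurs at the right place of a row. Every \<open>m \<ge> 1\<close> gives
  a different slope and the same word.

  In the formal description, \<open>breakout_orbit_orbit\<close> verifies the rules of the game. The bricks
  destroyed are pairwise distinct by \<open>event_brick_inj\<close>, so each of them is still there when it is hit,
  and \<open>path_clear\<close> shows that every grid line crossed between two impacts separates two empty cells.
\<close>

section \<open>Widening a row\<close>

text \<open>In the coordinate of a row whose origin is the entry and which is oriented towards the first brick
  hit, impact \<open>j\<close> takes place at time \<open>tri j\<close> and destroys the cell \<open>side j * reach j\<close>.\<close>

fun tri :: "nat \<Rightarrow> int" where
  "tri 0 = 0" | "tri (Suc j) = tri j + int (Suc j)"

definition reach :: "nat \<Rightarrow> int" where "reach j = int (j div 2) + 1"

definition side :: "nat \<Rightarrow> int" where "side j = (-1) ^ j"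

lemma side_cases: "side j = 1 \<or> side j = -1"
  by (cases "even j") (auto simp: side_def)

lemma side_Suc [simp]: "side (Suc j) = - side j"
  by (simp add: side_def)

lemma side_0 [simp]: "side 0 = 1"
  by (simp add: side_def)

lemma side_square [simp]: "side j * side j = 1"
  using side_cases[of j] by auto

lemma side_nonzero [simp]: "side j \<noteq> 0"
  using side_cases[of j] by auto

text \<open>Impacts \<open>j\<close> and \<open>j + 1\<close> hit the inner edges of the bricks \<open>reach j\<close> and \<open>- reach (j + 1)\<close> (up to a
  common sign). The distance of these edges is \<open>reach j + reach (j + 1) - 1\<close>, which explains the
  increments of \<open>tri\<close>.\<close>

lemma reach_Suc: "reach j + reach (Suc j) = int j + 2"
  unfolding reach_def by linarith

lemma tri_mono: "i \<le> j \<Longrightarrow> tri i \<le> tri j"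
  by (rule lift_Suc_mono_le[of tri]) auto

lemma side_reach_inj: "side j * reach j = side j' * reach j' \<Longrightarrow> j = j'"
proof -
  assume *: "side j * reach j = side j' * reach j'"
  have r: "reach j > 0" "reach j' > 0" by (auto simp: reach_def)
  have "side j = side j'"
  proof (rule ccontr)
    assume "side j \<noteq> side j'"
    then have "side j = - side j'" using side_cases[of j] side_cases[of j'] by auto
    then show False using * r side_cases[of j'] by auto
  qed
  then have "reach j = reach j'" "even j \<longleftrightarrow> even j'"
    using * side_cases[of j'] by (auto simp: side_def minus_one_power_iff split: if_splits)
  then have "j div 2 = j' div 2" "even j \<longleftrightarrow> even j'" by (simp_all add: reach_def)
  then show "j = j'" by presburger
qed

text \<open>The impacts \<open>0, \<dots>, J\<close> empty an interval around the entry, written here in the orientation in which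
  impact \<open>J\<close> is on the positive side.\<close>

lemma dug_offset_cases:
  assumes "- int (Suc J div 2) \<le> side J * w" "side J * w \<le> reach J"
  shows "w = 0 \<or> (\<exists>j\<le>J. w = side j * reach j)"
proof (cases "w = 0")
  case False
  define j where "j = (if w > 0 then nat (2 * (w - 1)) else nat (2 * (- w) - 1))"
  have side: "side j = (if w > 0 then 1 else -1)"
  proof (cases "w > 0")
    case True
    then have "even j" by (simp add: j_def even_nat_iff)
    then show ?thesis using True by (simp add: side_def)
  next
    case f: False
    then have "odd j" using False by (simp add: j_def even_nat_iff)
    then show ?thesis using f by (simp add: side_def)
  qed
  have "w = side j * reach j"
    using False unfolding side by (auto simp: j_def reach_def)
  moreover have "j \<le> J"
  proof (cases "even J")
    case True
    then have "side J = 1" by (simp add: side_def)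
    then show ?thesis using assms True False by (auto simp: j_def reach_def elim!: evenE)
  next
    case f: False
    then have "side J = -1" by (simp add: side_def)
    then show ?thesis using assms f False by (auto simp: j_def reach_def elim!: oddE)
  qed
  ultimately show ?thesis by blast
qed auto

section \<open>The events of a row\<close>

text \<open>The impacts in a row are numbered from \<open>0\<close> to \<open>30\<close>; numbers \<open>17\<close> and \<open>24\<close> are the impacts on the roof
  and on the floor. After impact \<open>i\<close> the ball moves horizontally as it does after the wall impact
  \<open>leg i\<close>, and it has met \<open>phase i\<close> horizontal grid lines since it entered the row. Conversely, the wall
  impact \<open>j\<close> has number \<open>slot j\<close>.\<close>

definition leg :: "nat \<Rightarrow> nat" where
  "leg i = (if i \<le> 16 then i else if i \<le> 23 then i - 1 else i - 2)"

definition phase :: "nat \<Rightarrow> nat" where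
  "phase i = (if i < 17 then 0 else if i < 24 then 1 else 2)"

definition slot :: "nat \<Rightarrow> nat" where
  "slot j = (if j \<le> 16 then j else if j \<le> 22 then j + 1 else j + 2)"

lemma slot_facts:
  assumes "j \<le> 28"
  shows "slot j \<le> 30" "slot j \<noteq> 17" "slot j \<noteq> 24" "leg (slot j) = j"
  using assms by (auto simp: slot_def leg_def)

lemma slot_mono: "i \<le> j \<Longrightarrow> slot i \<le> slot j"
  by (auto simp: slot_def)

lemma slot_leg_le: "slot (leg i) \<le> i"
  by (auto simp: slot_def leg_def)

section \<open>Grid lines and bricks\<close>

lemma vertical_line_edges:
  assumes "(of_int k, y) \<in> edges c" "of_int r < y" "y < of_int r + 1"
  shows "c = (k, r) \<or> c = (k - 1, r)"
proof -
  obtain c1 c2 where c: "c = (c1, c2)" by (cases c)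
  have "y \<noteq> of_int c2" "y \<noteq> of_int c2 + 1"
    using assms(2,3) by auto
  with assms(1) have "real_of_int k = of_int c1 \<or> real_of_int k = of_int c1 + 1" "of_int c2 \<le> y" "y \<le> of_int c2 + 1"
    unfolding c edges_def horizontal_edges_def vertical_edges_def by auto
  then have "k = c1 \<or> k = c1 + 1" "c2 = r" using assms(2,3) by linarith+
  then show ?thesis using c by auto
qed

lemma horizontal_line_edges:
  assumes "(x, of_int k) \<in> edges c" "of_int z < x" "x < of_int z + 1"
  shows "c = (z, k) \<or> c = (z, k - 1)"
proof -
  obtain c1 c2 where c: "c = (c1, c2)" by (cases c)
  have "x \<noteq> of_int c1" "x \<noteq> of_int c1 + 1"
    using assms(2,3) by auto
  with assms(1) have "real_of_int k = of_int c2 \<or> real_of_int k = of_int c2 + 1" "of_int c1 \<le> x" "x \<le> of_int c1 + 1"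
    unfolding c edges_def horizontal_edges_def vertical_edges_def by auto
  then have "k = c2 \<or> k = c2 + 1" "c1 = z" using assms(2,3) by linarith+
  then show ?thesis using c by auto
qed

lemma edges_meet_grid_line: "(x, y) \<in> edges c \<Longrightarrow> x \<in> \<int> \<or> y \<in> \<int>"
  unfolding edges_def horizontal_edges_def vertical_edges_def by auto

section \<open>The slopes and the crossing times\<close>

locale slope_family =
  fixes m :: nat
  assumes m_pos: "0 < m"
begin

text \<open>These are the solutions of \<open>1 / slope = 138 - 1 / (3 m)\<close> and \<open>launch / slope = 5 / (6 m)\<close>. The second
  condition, with a quotient strictly between \<open>2 / (3 m)\<close> and \<open>3 / (3 m)\<close>, makes the integer part of
  \<open>level_time i\<close> lose a unit exactly when \<open>i = 3 m l - 2\<close>, that is, at the first crossing of a row.\<close>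

definition slope :: real where "slope = 3 * real m / (414 * real m - 1)"
definition launch :: real where "launch = 5 / (2 * (414 * real m - 1))"
definition height :: "real \<Rightarrow> real" where "height X = launch + slope * X"
definition level_time :: "nat \<Rightarrow> real" where
  "level_time i = 138 * real i - (2 * real i + 5) / (6 * real m)"

text \<open>Row \<open>r\<close> is first hit at the integer time \<open>start r\<close>. The number \<open>advance r\<close>, which is \<open>0\<close> or \<open>1\<close>, is the
  number of time units by which the crossings of row \<open>r\<close> are early, compared with \<open>138\<close>, \<open>276\<close> and \<open>414\<close>.\<close>

definition advance :: "nat \<Rightarrow> int" where "advance r = int (Suc r div m) - int (r div m)"
definition start :: "nat \<Rightarrow> int" where "start r = 414 * int r - int (r div m)"

lemma m_ge1: "real m \<ge> 1" using m_pos by simp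

lemma slope_bounds: "0 < slope" "slope < 1"
  using m_ge1 by (auto simp: slope_def field_simps)

lemma launch_bounds: "0 < launch" "launch < 1"
  using m_ge1 by (auto simp: launch_def field_simps)

lemma height_eq: "height X = slope * (X + 5 / (6 * m))"
proof -
  have "414 * real m - 1 > 0" using m_ge1 by linarith
  then have "launch = slope * (5 / (6 * m))"
    using m_pos unfolding slope_def launch_def by (simp add: divide_eq_eq eq_divide_eq)
  then show ?thesis by (simp add: height_def distrib_left)
qed

lemma height_level_time: "height (level_time i) = i"
proof -
  have pos: "414 * real m - 1 > 0" using m_ge1 by linarith
  have "level_time i + 5 / (6 * m) = 138 * i - i / (3 * m)"
    using m_pos by (simp add: level_time_def field_simps)
  also have "\<dots> = i * (414 * m - 1) / (3 * m)"
    using m_pos by (simp add: field_simps)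
  finally show ?thesis using pos m_pos by (simp add: height_eq slope_def)
qed

lemma height_less_iff: "height X < height X' \<longleftrightarrow> X < X'"
  using slope_bounds(1) by (simp add: height_def)

lemma height_less_level: "height X < real i \<longleftrightarrow> X < level_time i"
  using height_less_iff[of X "level_time i"] by (simp add: height_level_time)

lemma level_less_height: "real i < height X \<longleftrightarrow> level_time i < X"
  using height_less_iff[of "level_time i" X] by (simp add: height_level_time)

lemma height_eq_level: "height X = real i \<longleftrightarrow> X = level_time i"
  using height_less_level[of X i] level_less_height[of i X] by auto

lemma level_time_less_iff: "level_time i < level_time l \<longleftrightarrow> i < l"
  using height_less_iff[of "level_time i" "level_time l"] by (simp add: height_level_time)

text \<open>The ball is on a vertical grid line exactly at integer times, so this keeps it away from the
  lattice points. The reason is a parity: \<open>6 m\<close> times the crossing time is an odd number, because of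
  the \<open>5\<close> in the launching height.\<close>

lemma level_time_not_Ints: "level_time i \<notin> \<int>"
proof
  assume "level_time i \<in> \<int>"
  then obtain k where k: "level_time i = of_int k" by (auto elim: Ints_cases)
  have "6 * real m * of_int k = 6 * real m * level_time i" by (simp add: k)
  also have "\<dots> = 828 * real m * real i - (2 * real i + 5)"
    using m_ge1 by (simp add: level_time_def field_simps)
  finally have "of_int (6 * int m * k) = (of_int (828 * int m * int i - (2 * int i + 5)) :: real)" by simp
  then have "6 * int m * k = 828 * int m * int i - (2 * int i + 5)" by (simp only: of_int_eq_iff)
  then have "even (828 * int m * int i - (2 * int i + 5))" by (metis dvd_mult2 even_numeral)
  then show False by simp
qed

lemma advance_cases: "advance r = 0 \<or> advance r = 1"
proof -
  have "r div m \<le> Suc r div m" by (simp add: div_le_mono)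
  moreover have "Suc r div m \<le> (r + m) div m" using m_pos by (intro div_le_mono) simp
  moreover have "(r + m) div m = Suc (r div m)" using m_pos by simp
  ultimately have "Suc r div m = r div m \<or> Suc r div m = Suc (r div m)" by linarith
  then show ?thesis by (auto simp: advance_def)
qed

lemma start_Suc: "start (Suc r) = start r + 414 - advance r"
  by (simp add: start_def advance_def)

lemma start_0: "start 0 = 0"
  by (simp add: start_def)

text \<open>The three crossings of a row share the advance: writing \<open>r + 1 = m q + \<rho>\<close> with \<open>\<rho> < m\<close>, the correction
  \<open>(2 i + 5) / (6 m)\<close> in \<open>level_time i\<close> is \<open>q\<close> plus one of \<open>(6 \<rho> + 1) / (6 m)\<close>, \<open>(6 \<rho> + 3) / (6 m)\<close> and
  \<open>(6 \<rho> + 5) / (6 m)\<close>, all of which are less than \<open>1\<close>.\<close>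

lemma level_time_bounds:
  assumes "f \<le> 2"
  shows "of_int (start r) + 138 * (1 + real f) - of_int (advance r) - 1 < level_time (3 * r + 1 + f)"
    and "level_time (3 * r + 1 + f) < of_int (start r) + 138 * (1 + real f) - of_int (advance r)"
proof -
  define q where "q = Suc r div m"
  define \<rho> where "\<rho> = Suc r mod m"
  have r: "Suc r = m * q + \<rho>" by (simp add: q_def \<rho>_def)
  have "\<rho> + 1 \<le> m" using m_pos by (simp add: \<rho>_def Suc_leI)
  then have rho: "real \<rho> + 1 \<le> m" by linarith
  have "real (Suc r) = real (m * q + \<rho>)" by (simp only: r)
  then have r': "real r = real m * real q + real \<rho> - 1" by simp
  define \<phi> where "\<phi> = (6 * real \<rho> + 1 + 2 * f) / (6 * m)"
  have phi: "0 < \<phi>" "\<phi> < 1" using rho m_pos assms by (auto simp: \<phi>_def field_simps)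
  have "(2 * real (3 * r + 1 + f) + 5) / (6 * m) = q + \<phi>"
    using m_pos by (simp add: \<phi>_def field_simps r')
  then have t: "level_time (3 * r + 1 + f) = 138 * (3 * real r + 1 + real f) - real q - \<phi>"
    by (simp add: level_time_def)
  have s: "real_of_int (start r) - of_int (advance r) = 414 * real r - real q"
    by (simp add: start_def advance_def q_def)
  show "of_int (start r) + 138 * (1 + real f) - of_int (advance r) - 1 < level_time (3 * r + 1 + f)"
    using phi s unfolding t distrib_left by linarith
  show "level_time (3 * r + 1 + f) < of_int (start r) + 138 * (1 + real f) - of_int (advance r)"
    using phi s unfolding t distrib_left by linarith
qed

lemma level_time_less_start: "level_time (3 * r) < of_int (start r)"
proof (cases r)
  case 0
  then show ?thesis using m_pos by (simp add: level_time_def start_0 field_simps)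
next
  case (Suc r')
  have "3 * r = 3 * r' + 1 + 2" using Suc by simp
  moreover have "real_of_int (start r) = start r' + 414 - advance r'" by (simp add: Suc start_Suc)
  ultimately show ?thesis using level_time_bounds(2)[of 2 r'] by simp
qed

section \<open>The orbit\<close>

text \<open>The rows are dug alternately in both orientations, so \<open>side r\<close> is also the orientation of row \<open>r\<close>.\<close>

primrec entry :: "nat \<Rightarrow> int" where
  "entry 0 = -1"
| "entry (Suc r) = entry r + side r * (7 + advance r)"

definition event_time :: "nat \<Rightarrow> nat \<Rightarrow> real" where
  "event_time r i =
     (if i = 17 then level_time (3 * r + 1)
      else if i = 24 then level_time (3 * r + 2)
      else of_int (start r + tri (leg i)))"

text \<open>The abscissa during leg \<open>j\<close> of row \<open>r\<close>. The formulas for the position are used as functions of time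
  without restriction; consecutive ones agree at the impacts.\<close>

definition abscissa :: "nat \<Rightarrow> nat \<Rightarrow> real \<Rightarrow> real" where
  "abscissa r j X = of_int (entry r) + 1/2
     + of_int (side r * side j) * (of_int (reach j + start r + tri j) - 1/2 - X)"

definition ordinate :: "nat \<Rightarrow> nat \<Rightarrow> real \<Rightarrow> real" where
  "ordinate r f X =
     (if f = 0 then height X - 2 * r
      else if f = 1 then 4 * r + 2 - height X
      else height X - 2 * r - 2)"

definition position :: "nat \<Rightarrow> nat \<Rightarrow> real \<Rightarrow> point" where
  "position r i X = (abscissa r (leg i) X, ordinate r (phase i) X)"

definition velocity :: "nat \<Rightarrow> nat \<Rightarrow> point" where
  "velocity r i = (- of_int (side r * side (leg i)), if phase i = 1 then - slope else slope)"

text \<open>The offsets \<open>7 + advance r\<close>, which appears in \<open>entry\<close>, and \<open>advance r - 11\<close> are those of the columns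
  in which the ball is at its first and at its second crossing; the brick broken in the roof gives the
  entry of the next row.\<close>

definition event_brick :: "nat \<Rightarrow> nat \<Rightarrow> cell" where
  "event_brick r i =
     (if i = 17 then (entry (Suc r), int r + 1)
      else if i = 24 then (entry r + side r * (advance r - 11), int r - 1)
      else (entry r + side r * (side (leg i) * reach (leg i)), int r))"

definition event :: "nat \<Rightarrow> nat \<Rightarrow> impact" where
  "event r i =
     \<lparr>brick = event_brick r i, site = position r i (event_time r i),
      incoming = (if i = 17 \<or> i = 24 then (fst (velocity r i), - snd (velocity r i))
                  else (- fst (velocity r i), snd (velocity r i)))\<rparr>"

definition orbit :: "nat \<Rightarrow> impact" where
  "orbit n = event (n div 31) (n mod 31)"

definition next_time :: "nat \<Rightarrow> nat \<Rightarrow> real" where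
  "next_time r i = (if i < 30 then event_time r (Suc i) else event_time (Suc r) 0)"

definition next_event :: "nat \<Rightarrow> nat \<Rightarrow> impact" where
  "next_event r i = (if i < 30 then event r (Suc i) else event (Suc r) 0)"

lemma orbit_Suc: "orbit (Suc n) = next_event (n div 31) (n mod 31)"
proof (cases "n mod 31 < 30")
  case True
  then show ?thesis by (simp add: orbit_def next_event_def mod_Suc div_Suc)
next
  case False
  then have "n mod 31 = 30" using mod_less_divisor[of 31 n] by linarith
  then show ?thesis by (simp add: orbit_def next_event_def mod_Suc div_Suc)
qed

lemma orbit_event: "i < 31 \<Longrightarrow> orbit (31 * r + i) = event r i"
  by (simp add: orbit_def)

lemma tri_values: "tri 16 = 136" "tri 17 = 153" "tri 22 = 253" "tri 23 = 276" "tri 28 = 406" "tri 29 = 435"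
  by (simp_all add: eval_nat_numeral)

text \<open>The integer times of the wall impacts next to these crossings are \<open>136\<close> and \<open>153\<close>, \<open>253\<close> and \<open>276\<close>, and
  \<open>406\<close> and \<open>414 - advance r\<close>, counted from the start of the row. So the order of the impacts does not depend
  on the advance.\<close>

lemma event_time_17:
  "of_int (start r) + 137 - of_int (advance r) < event_time r 17"
  "event_time r 17 < of_int (start r) + 138 - of_int (advance r)"
proof -
  have "event_time r 17 = level_time (3 * r + 1 + 0)" by (simp add: event_time_def)
  with level_time_bounds[of 0 r]
  show "of_int (start r) + 137 - of_int (advance r) < event_time r 17"
    "event_time r 17 < of_int (start r) + 138 - of_int (advance r)" by simp_all
qed

lemma event_time_24:
  "of_int (start r) + 275 - of_int (advance r) < event_time r 24"
  "event_time r 24 < of_int (start r) + 276 - of_int (advance r)"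
proof -
  have "event_time r 24 = level_time (3 * r + 1 + 1)" by (simp add: event_time_def)
  with level_time_bounds[of 1 r]
  show "of_int (start r) + 275 - of_int (advance r) < event_time r 24"
    "event_time r 24 < of_int (start r) + 276 - of_int (advance r)" by simp_all
qed

lemma passage_time:
  "of_int (start r) + 413 - of_int (advance r) < level_time (3 * r + 3)"
  "level_time (3 * r + 3) < of_int (start r) + 414 - of_int (advance r)"
proof -
  have e: "3 * r + 3 = 3 * r + 1 + 2" by simp
  show "of_int (start r) + 413 - of_int (advance r) < level_time (3 * r + 3)"
    "level_time (3 * r + 3) < of_int (start r) + 414 - of_int (advance r)"
    unfolding e using level_time_bounds[of 2 r] by simp_all
qed

lemma advance_bounds: "0 \<le> real_of_int (advance r)" "real_of_int (advance r) \<le> 1"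
  using advance_cases[of r] by auto

lemma event_time_less_next: 
  assumes "i \<le> 30"
  shows "event_time r i < next_time r i"
proof -
  consider "i = 16" | "i = 17" | "i = 23" | "i = 24" | "i = 30" | "i < 30" "i \<notin> {16,17,23,24}" using assms by fastforce
  then show ?thesis
  proof cases
    case 1
    then show ?thesis using event_time_17[of r] advance_bounds[of r] tri_values
      by (simp add: next_time_def event_time_def leg_def)
  next
    case 2
    then have "next_time r i = of_int (start r + 153)" by (simp add: next_time_def event_time_def leg_def tri_values)
    then show ?thesis using 2 event_time_17[of r] advance_bounds[of r] by simp
  next
    case 3
    then have "event_time r i = of_int (start r + 253)" "next_time r i = event_time r 24"
      by (simp_all add: next_time_def event_time_def leg_def tri_values)
    then show ?thesis using event_time_24[of r] advance_bounds[of r] by simp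
  next
    case 4
    then have "next_time r i = of_int (start r + 276)" by (simp add: next_time_def event_time_def leg_def tri_values)
    then show ?thesis using 4 event_time_24[of r] advance_bounds[of r] by simp
  next
    case 5
    then show ?thesis using advance_cases[of r] by (auto simp: next_time_def event_time_def leg_def tri_values start_Suc)
  next
    case 6
    then have "leg (Suc i) = Suc (leg i)" "i \<noteq> 17" "i \<noteq> 24" "Suc i \<noteq> 17" "Suc i \<noteq> 24" 
      by (auto simp: leg_def)
    then show ?thesis using 6 by (simp add: next_time_def event_time_def)
  qed
qed

lemma position_along: "position r i (X + s) = position r i X + s *\<^sub>R velocity r i"
  by (simp add: position_def velocity_def abscissa_def ordinate_def height_def phase_def algebra_simps)

lemma abscissa_Ints_iff: "abscissa r j X \<in> \<int> \<longleftrightarrow> X \<in> \<int>"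
proof -
  let ?K = "reach j + start r + tri j"
  have "side r * side j = 1 \<or> side r * side j = -1"
    using side_cases[of r] side_cases[of j] by auto
  then consider "abscissa r j X = of_int (entry r + ?K) - X"
    | "abscissa r j X = of_int (entry r + 1 - ?K) + X"
    unfolding abscissa_def by fastforce
  then show ?thesis
  proof cases
    case 1
    then have "X = of_int (entry r + ?K) - abscissa r j X" by simp
    then show ?thesis using 1 by (metis Ints_diff Ints_of_int)
  next
    case 2
    then have "X = abscissa r j X - of_int (entry r + 1 - ?K)" by simp
    then show ?thesis using 2 by (metis Ints_diff Ints_add Ints_of_int)
  qed
qed

lemma ordinate_Ints:
  assumes "ordinate r f X \<in> \<int>" "0 \<le> X"
  shows "\<exists>i. X = level_time i"
proof -
  have "height X \<in> \<int>"
  proof -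
    obtain z where z: "ordinate r f X = of_int z" using assms(1) by (auto elim: Ints_cases)
    have "height X = of_int (z + 2 * int r) \<or> height X = of_int (4 * int r + 2 - z) \<or> height X = of_int (z + 2 * int r + 2)"
      using z by (auto simp: ordinate_def split: if_splits)
    then show ?thesis using Ints_of_int by metis
  qed
  then obtain z where z: "height X = of_int z" by (auto elim: Ints_cases)
  have "0 < height X" using assms(2) launch_bounds slope_bounds by (simp add: height_def add_pos_nonneg)
  then have "height X = real (nat z)" using z by simp
  then show ?thesis using height_eq_level by blast
qed

lemma position_not_lattice:
  assumes "0 \<le> X"
  shows "position r i X \<notin> \<int> \<times> \<int>"
proof
  assume "position r i X \<in> \<int> \<times> \<int>"
  then have "X \<in> \<int>" "ordinate r (phase i) X \<in> \<int>" by (simp_all add: position_def abscissa_Ints_iff)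
  then show False using ordinate_Ints[OF _ assms] level_time_not_Ints by blast
qed

lemma start_nonneg: "0 \<le> start r"
proof -
  have "r div m \<le> r" by simp
  then have "int (r div m) \<le> int r" by (simp only: of_nat_le_iff)
  then show ?thesis unfolding start_def by linarith
qed

lemma tri_nonneg: "0 \<le> tri j"
  using tri_mono[of 0 j] by simp

section \<open>Where the ball is between two impacts\<close>

lemma leg_window:
  assumes "i \<le> 30"
  shows "of_int (start r + tri (leg i)) \<le> event_time r i"
    and "next_time r i \<le> of_int (start r + tri (Suc (leg i)))"
proof -
  consider "i = 17" | "i = 24" | "i \<noteq> 17" "i \<noteq> 24" by blast
  then show "of_int (start r + tri (leg i)) \<le> event_time r i"
    using event_time_17[of r] event_time_24[of r] advance_bounds[of r]
    by cases (simp_all add: leg_def tri_values, simp add: event_time_def leg_def)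
next
  consider "i = 16" | "i = 23" | "i = 30" | "i < 30" "i \<noteq> 16" "i \<noteq> 23" using assms by linarith
  then show "next_time r i \<le> of_int (start r + tri (Suc (leg i)))"
  proof cases
    case 1
    then show ?thesis using event_time_17[of r] advance_bounds[of r] tri_values(2) by (simp add: next_time_def leg_def)
  next
    case 2
    then show ?thesis using event_time_24[of r] advance_bounds[of r] tri_values(4) by (simp add: next_time_def leg_def)
  next
    case 3
    then show ?thesis using advance_bounds[of r] tri_values(6)
      by (simp add: next_time_def leg_def event_time_def start_Suc)
  next
    case 4
    have "tri (leg (Suc i)) \<le> tri (Suc (leg i))" by (rule tri_mono) (auto simp: leg_def)
    then show ?thesis using 4 by (simp add: next_time_def event_time_def)
  qed
qed

lemma phase_window:
  assumes "i \<le> 30"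
  shows "level_time (3 * r + phase i) \<le> event_time r i"
    and "i < 30 \<Longrightarrow> next_time r i \<le> level_time (3 * r + phase i + 1)"
proof -
  consider "i < 17" | "i = 17" | "17 < i" "i < 24" | "i = 24" | "24 < i" by linarith
  then show "level_time (3 * r + phase i) \<le> event_time r i"
  proof cases
    case 1
    then show ?thesis using level_time_less_start[of r] tri_nonneg[of "leg i"] by (simp add: event_time_def phase_def)
  next
    case 3
    then have "tri 17 \<le> tri (leg i)" by (intro tri_mono) (auto simp: leg_def)
    then have "tri (leg i) \<ge> 153" by (simp only: tri_values)
    then have "real_of_int (tri (leg i)) \<ge> 153" by linarith
    moreover have "event_time r i = of_int (start r) + of_int (tri (leg i))" using 3 by (simp add: event_time_def)
    moreover have "level_time (3 * r + phase i) = event_time r 17" using 3 by (simp add: event_time_def phase_def)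
    ultimately show ?thesis using event_time_17[of r] advance_bounds[of r] by linarith
  next
    case 5
    then have "tri 23 \<le> tri (leg i)" by (intro tri_mono) (auto simp: leg_def)
    then have "tri (leg i) \<ge> 276" by (simp only: tri_values)
    then have "real_of_int (tri (leg i)) \<ge> 276" by linarith
    moreover have "event_time r i = of_int (start r) + of_int (tri (leg i))" using 5 by (simp add: event_time_def)
    moreover have "level_time (3 * r + phase i) = event_time r 24" using 5 by (simp add: event_time_def phase_def)
    ultimately show ?thesis using event_time_24[of r] advance_bounds[of r] by linarith
  qed (simp_all add: event_time_def phase_def)
next
  assume i: "i < 30"
  have step: "next_time r i = of_int (start r) + of_int (tri (leg (Suc i)))" if "i \<noteq> 16" "i \<noteq> 23"
    using that i by (simp add: next_time_def event_time_def)
  consider "i < 16" | "i = 16" | "16 < i" "i < 23" | "i = 23" | "23 < i" by linarith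
  then show "next_time r i \<le> level_time (3 * r + phase i + 1)"
  proof cases
    case 1
    then have "tri (leg (Suc i)) \<le> tri 16" by (intro tri_mono) (auto simp: leg_def)
    then have "real_of_int (tri (leg (Suc i))) \<le> 136" by (simp add: tri_values)
    moreover have "level_time (3 * r + phase i + 1) = event_time r 17" using 1 by (simp add: event_time_def phase_def)
    ultimately show ?thesis using 1 step event_time_17[of r] advance_bounds[of r] by simp
  next
    case 3
    then have "tri (leg (Suc i)) \<le> tri 22" by (intro tri_mono) (auto simp: leg_def)
    then have "real_of_int (tri (leg (Suc i))) \<le> 253" by (simp add: tri_values)
    moreover have "level_time (3 * r + phase i + 1) = event_time r 24" using 3 by (simp add: event_time_def phase_def)
    ultimately show ?thesis using 3 step event_time_24[of r] advance_bounds[of r] by simp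
  next
    case 5
    then have "tri (leg (Suc i)) \<le> tri 28" using i by (intro tri_mono) (auto simp: leg_def)
    then have *: "real_of_int (tri (leg (Suc i))) \<le> 406" by (simp add: tri_values)
    have "3 * r + phase i + 1 = 3 * r + 3" using 5 by (simp add: phase_def)
    then have "level_time (3 * r + phase i + 1) = level_time (3 * r + 3)" by (simp only:)
    moreover have "next_time r i = of_int (start r) + of_int (tri (leg (Suc i)))" using 5 step by simp
    ultimately show ?thesis using * passage_time[of r] advance_bounds[of r] by linarith
  qed (simp_all add: next_time_def event_time_def phase_def)
qed

lemma ordinate_in_row:
  assumes "f \<le> 2" "level_time (3 * r + f) < X" "X < level_time (3 * r + f + 1)"
  shows "real r < ordinate r f X" "ordinate r f X < real r + 1"
proof -
  have *: "real (3 * r + f) < height X" "height X < real (3 * r + f + 1)"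
    using assms(2,3) by (simp_all only: level_less_height height_less_level)
  have "f = 0 \<or> f = 1 \<or> f = 2" using assms(1) by linarith
  with * show "real r < ordinate r f X" "ordinate r f X < real r + 1" by (auto simp: ordinate_def)
qed

lemma side_times_half: 
  assumes "e = 1 \<or> e = (-1::int)" "\<bar>u - real_of_int w\<bar> < 1/2"
  shows "of_int (z + e * w) < of_int z + 1/2 + of_int e * u" "of_int z + 1/2 + of_int e * u < of_int (z + e * w) + 1"
  using assms unfolding abs_less_iff by auto

lemma abscissa_in_column:
  assumes "\<bar>of_int (reach j + start r + tri j) - 1/2 - X - of_int w\<bar> < 1/2"
  shows "of_int (entry r + side r * (side j * w)) < abscissa r j X"
    and "abscissa r j X < of_int (entry r + side r * (side j * w)) + 1"
proof -
  have "side r * side j = 1 \<or> side r * side j = -1"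
    using side_cases[of r] side_cases[of j] by auto
  from side_times_half[OF this assms, of "entry r"]
  show "of_int (entry r + side r * (side j * w)) < abscissa r j X"
    "abscissa r j X < of_int (entry r + side r * (side j * w)) + 1"
    unfolding abscissa_def by (simp_all only: mult.assoc)
qed

lemma side_values: "side 16 = 1" "side 22 = 1" "side 28 = 1"
  by (simp_all add: side_def)

lemma reach_values: "reach 16 = 9" "reach 22 = 12" "reach 28 = 15"
  by (simp_all add: reach_def)

text \<open>Almost two units after wall impact \<open>16\<close> and almost eight units after wall impact \<open>28\<close> the ball is in the same
  column, and an advance moves both places by one cell. This coincidence, seen by comparing with
  \<open>passage_column\<close> below, lets the ball leave the row.\<close>

lemma roof_column:
  "of_int (entry (Suc r)) < abscissa r 16 (event_time r 17)"
  "abscissa r 16 (event_time r 17) < of_int (entry (Suc r)) + 1"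
proof -
  have "\<bar>of_int (reach 16 + start r + tri 16) - 1/2 - event_time r 17 - of_int (7 + advance r)\<bar> < 1/2"
    using event_time_17[of r] unfolding reach_values tri_values abs_less_iff by simp
  from abscissa_in_column[OF this]
  show "of_int (entry (Suc r)) < abscissa r 16 (event_time r 17)"
    "abscissa r 16 (event_time r 17) < of_int (entry (Suc r)) + 1"
    by (simp_all add: side_values)
qed

lemma floor_column:
  "of_int (entry r + side r * (advance r - 11)) < abscissa r 22 (event_time r 24)"
  "abscissa r 22 (event_time r 24) < of_int (entry r + side r * (advance r - 11)) + 1"
proof -
  have "\<bar>of_int (reach 22 + start r + tri 22) - 1/2 - event_time r 24 - of_int (advance r - 11)\<bar> < 1/2"
    using event_time_24[of r] unfolding reach_values tri_values abs_less_iff by simp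
  from abscissa_in_column[OF this]
  show "of_int (entry r + side r * (advance r - 11)) < abscissa r 22 (event_time r 24)"
  "abscissa r 22 (event_time r 24) < of_int (entry r + side r * (advance r - 11)) + 1"
    by (simp_all add: side_values)
qed

lemma passage_column:
  "of_int (entry (Suc r)) < abscissa r 28 (level_time (3 * r + 3))"
  "abscissa r 28 (level_time (3 * r + 3)) < of_int (entry (Suc r)) + 1"
proof -
  have "\<bar>of_int (reach 28 + start r + tri 28) - 1/2 - level_time (3 * r + 3) - of_int (7 + advance r)\<bar> < 1/2"
    using passage_time[of r] unfolding reach_values tri_values abs_less_iff by simp
  from abscissa_in_column[OF this]
  show "of_int (entry (Suc r)) < abscissa r 28 (level_time (3 * r + 3))"
    "abscissa r 28 (level_time (3 * r + 3)) < of_int (entry (Suc r)) + 1"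
    by (simp_all add: side_values)
qed

section \<open>Consecutive impacts\<close>

lemma abscissa_at_turn:
  "abscissa r (Suc j) (of_int (start r + tri (Suc j))) = abscissa r j (of_int (start r + tri (Suc j)))"
proof -
  have k: "reach (Suc j) = int j + 2 - reach j" using reach_Suc[of j] by linarith
  show ?thesis by (simp add: abscissa_def k algebra_simps)
qed

lemma abscissa_row_change:
  "abscissa (Suc r) 0 (of_int (start (Suc r))) = abscissa r 28 (of_int (start (Suc r)))"
  by (simp add: abscissa_def side_values reach_values tri_values start_Suc algebra_simps reach_def)

lemma next_event_site:
  assumes "i \<le> 30"
  shows "site (next_event r i) = position r i (next_time r i)"
proof -
  consider "i = 16" | "i = 23" | "i = 30" | "i < 30" "i \<noteq> 16" "i \<noteq> 23" using assms by linarith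
  then show ?thesis
  proof cases
    case 1
    have "height (event_time r 17) = real (3 * r + 1)" by (simp add: event_time_def height_level_time)
    then show ?thesis using 1
      by (simp add: next_event_def next_time_def event_def position_def leg_def phase_def ordinate_def)
  next
    case 2
    have "height (event_time r 24) = real (3 * r + 2)" by (simp add: event_time_def height_level_time)
    then show ?thesis using 2
      by (simp add: next_event_def next_time_def event_def position_def leg_def phase_def ordinate_def)
  next
    case 3
    have t: "event_time (Suc r) 0 = of_int (start (Suc r))" by (simp add: event_time_def leg_def)
    show ?thesis unfolding 3
      by (simp add: next_event_def next_time_def event_def position_def t abscissa_row_change leg_def phase_def ordinate_def)
  next
    case 4
    then have l: "leg (Suc i) = Suc (leg i)" "phase (Suc i) = phase i"
      by (auto simp: leg_def phase_def)
    then have "event_time r (Suc i) = of_int (start r + tri (Suc (leg i)))"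
      using 4 by (simp add: event_time_def)
    then show ?thesis using 4 l abscissa_at_turn[of r "leg i"]
      by (simp add: next_event_def next_time_def event_def position_def)
  qed
qed

lemma wall_event_time:
  assumes "i \<le> 30" "i \<noteq> 17" "i \<noteq> 24"
  shows "level_time (3 * r + phase i) < event_time r i" "event_time r i < level_time (3 * r + phase i + 1)"
proof -
  have e: "event_time r i = of_int (start r + tri (leg i))" using assms by (simp add: event_time_def)
  then have "event_time r i \<in> \<int>" by simp
  then have "event_time r i \<noteq> level_time (3 * r + phase i)" using level_time_not_Ints by metis
  then show "level_time (3 * r + phase i) < event_time r i" using phase_window(1)[OF assms(1), of r] by simp
  show "event_time r i < level_time (3 * r + phase i + 1)"
  proof (cases "i = 30")
    case True
    then have "level_time (3 * r + phase i + 1) = level_time (3 * r + 3)" by (simp add: phase_def numeral_3_eq_3)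
    moreover have "event_time r i = of_int (start r) + 406" using True e by (simp add: leg_def tri_values)
    ultimately show ?thesis using passage_time[of r] advance_bounds[of r] by linarith
  next
    case False
    then have "i < 30" using assms(1) by simp
    from phase_window(2)[OF assms(1) this, of r] event_time_less_next[OF assms(1), of r] show ?thesis by linarith
  qed
qed

lemma phase_le_2: "phase i \<le> 2"
  by (simp add: phase_def)

text \<open>At integer times the ball is on a vertical grid line, and the cells on both sides of this line have
  offsets that differ by one. The alternative is which of the two is on the left.\<close>

lemma abscissa_on_grid:
  fixes s :: int
  obtains x where "abscissa r j (of_int (start r + tri j + s)) = of_int x"
    "x = entry r + side r * (side j * (reach j - s)) \<and>
       x - 1 = entry r + side r * (side j * (reach j - (s + 1)))
     \<or> x - 1 = entry r + side r * (side j * (reach j - s)) \<and>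
       x = entry r + side r * (side j * (reach j - (s + 1)))"
proof -
  have sign: "side r * (side j * t) = (side r * side j) * t" for t by simp
  have "side r * side j = 1 \<or> side r * side j = -1"
    using side_cases[of r] side_cases[of j] by auto
  then show ?thesis
  proof
    assume e: "side r * side j = 1"
    have "abscissa r j (of_int (start r + tri j + s)) = of_int (entry r + reach j - s)"
      by (simp add: abscissa_def e del: of_int_mult)
    then show ?thesis by (rule that) (simp add: sign e)
  next
    assume e: "side r * side j = -1"
    have "abscissa r j (of_int (start r + tri j + s)) = of_int (entry r + 1 - (reach j - s))"
      by (simp add: abscissa_def e del: of_int_mult)
    then show ?thesis by (rule that) (simp add: sign e)
  qed
qed

lemma wall_abscissa:
  assumes "i \<noteq> 17" "i \<noteq> 24"
  shows "abscissa r (leg i) (event_time r i) \<in>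
     {of_int (entry r + side r * (side (leg i) * reach (leg i))),
      of_int (entry r + side r * (side (leg i) * reach (leg i))) + 1}"
proof -
  have t: "event_time r i = of_int (start r + tri (leg i) + 0)" using assms by (simp add: event_time_def)
  let ?c = "entry r + side r * (side (leg i) * reach (leg i))"
  obtain x where x: "abscissa r (leg i) (event_time r i) = of_int x" and "x = ?c \<or> x - 1 = ?c"
    unfolding t by (rule abscissa_on_grid[of r "leg i" 0]) auto
  then have "x = ?c \<or> x = ?c + 1" by linarith
  then show ?thesis unfolding x by (metis insertCI of_int_1 of_int_add)
qed

lemma wall_event_edges:
  assumes "i \<le> 30" "i \<noteq> 17" "i \<noteq> 24"
  shows "site (event r i) \<in> vertical_edges (brick (event r i))"
    and "site (event r i) \<notin> horizontal_edges (brick (event r i))"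
proof -
  note o = ordinate_in_row[OF phase_le_2 wall_event_time[OF assms], of r]
  show "site (event r i) \<in> vertical_edges (brick (event r i))"
    using o wall_abscissa[OF assms(2,3), of r] assms(2,3)
    by (simp add: event_def event_brick_def position_def vertical_edges_def)
  show "site (event r i) \<notin> horizontal_edges (brick (event r i))"
    using o assms(2,3)
    by (simp add: event_def event_brick_def position_def horizontal_edges_def)
qed

lemma ceiling_event_edges:
  assumes "i = 17 \<or> i = 24"
  shows "site (event r i) \<in> horizontal_edges (brick (event r i))"
  using assms
proof
  assume i: "i = 17"
  have "height (event_time r 17) = 3 * real r + 1" using height_level_time[of "3 * r + 1"] by (simp add: event_time_def)
  then show ?thesis using roof_column[of r]
    by (simp add: i event_def event_brick_def position_def horizontal_edges_def leg_def phase_def ordinate_def)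
next
  assume i: "i = 24"
  have "height (event_time r 24) = 3 * real r + 2" using height_level_time[of "3 * r + 2"] by (simp add: event_time_def)
  then show ?thesis using floor_column[of r]
    by (simp add: i event_def event_brick_def position_def horizontal_edges_def leg_def phase_def ordinate_def)
qed

lemma hits_horizontal_event:
  assumes "i \<le> 30"
  shows "hits_horizontal (event r i) \<longleftrightarrow> i = 17 \<or> i = 24"
  using ceiling_event_edges[of i r] wall_event_edges(2)[OF assms, of r]
  by (auto simp: hits_horizontal_def)

lemma site_event_edges:
  assumes "i \<le> 30"
  shows "site (event r i) \<in> edges (brick (event r i))"
  using ceiling_event_edges[of i r] wall_event_edges(1)[OF assms, of r]
  by (auto simp: edges_def)

lemma outgoing_event:
  assumes "i \<le> 30"
  shows "outgoing (event r i) = velocity r i"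
  using hits_horizontal_event[OF assms, of r]
  by (simp add: outgoing_def event_def)

lemma next_event_incoming:
  assumes "i \<le> 30"
  shows "incoming (next_event r i) = velocity r i"
proof -
  consider "i = 16" | "i = 23" | "i = 30" | "i < 30" "i \<noteq> 16" "i \<noteq> 23" using assms by linarith
  then show ?thesis
  proof cases
    case 4
    then have "leg (Suc i) = Suc (leg i)" "phase (Suc i) = phase i"
      by (auto simp: leg_def phase_def)
    then show ?thesis using 4 by (simp add: next_event_def event_def velocity_def)
  qed (simp_all add: next_event_def event_def velocity_def leg_def phase_def side_values)
qed

section \<open>No brick is hit twice\<close>

lemma event_brick_wall: "\<lbrakk>i \<noteq> 17; i \<noteq> 24\<rbrakk> \<Longrightarrow> event_brick r i = (entry r + side r * (side (leg i) * reach (leg i)), int r)"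
  by (simp add: event_brick_def)

lemma event_brick_roof: "event_brick r 17 = (entry (Suc r), int (Suc r))"
  by (simp add: event_brick_def)

lemma event_brick_floor: "event_brick r 24 = (entry r + side r * (advance r - 11), int r - 1)"
  by (simp add: event_brick_def)

text \<open>Seen from row \<open>r\<close>, the floor brick destroyed from row \<open>r + 1\<close> lies beyond the end of the tunnel, which
  reaches only to the offset \<open>15\<close>. So it is still there when it is hit.\<close>

lemma event_brick_floor_Suc:
  "event_brick (Suc r) 24 = (entry r + side r * (18 + advance r - advance (Suc r)), int r)"
  by (simp add: event_brick_def algebra_simps)

lemma side_cancel: "z + side r * v = z + side r * w \<longleftrightarrow> v = w"
  using side_cases[of r] by auto

lemma side_cancel_0: "z + side r * v = z \<longleftrightarrow> v = 0"
  using side_cases[of r] by auto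

lemma reach_bounds: "i \<le> 30 \<Longrightarrow> 1 \<le> \<bar>side (leg i) * reach (leg i)\<bar> \<and> \<bar>side (leg i) * reach (leg i)\<bar> \<le> 15"
proof -
  assume "i \<le> 30"
  then have "leg i \<le> 28" by (auto simp: leg_def)
  then have "leg i div 2 \<le> 28 div 2" by (intro div_le_mono)
  then have "1 \<le> reach (leg i)" "reach (leg i) \<le> 15" by (simp_all add: reach_def)
  then show ?thesis using side_cases[of "leg i"] by auto
qed

lemma floor_offset: "17 \<le> 18 + advance r - advance (Suc r)"
  using advance_cases[of r] advance_cases[of "Suc r"] by auto

lemma wall_neq_roof: "\<lbrakk>i \<le> 30; i \<noteq> 17; i \<noteq> 24\<rbrakk> \<Longrightarrow> event_brick r i \<noteq> event_brick r' 17"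
proof
  assume i: "i \<le> 30" "i \<noteq> 17" "i \<noteq> 24" and *: "event_brick r i = event_brick r' 17"
  then have "int r = int (Suc r')" unfolding event_brick_wall[OF i(2,3)] event_brick_roof prod.inject by blast
  then have "r = Suc r'" by (simp only: of_nat_eq_iff)
  then have "side (leg i) * reach (leg i) = 0"
    using * unfolding event_brick_wall[OF i(2,3)] event_brick_roof prod.inject by (simp only: side_cancel_0)
  then show False using reach_bounds[OF i(1)] by linarith
qed

lemma wall_neq_floor: 
  assumes "i \<le> 30" "i \<noteq> 17" "i \<noteq> 24"
  shows "event_brick r i \<noteq> event_brick r' 24"
proof
  assume *: "event_brick r i = event_brick r' 24"
  then have "r' = Suc r" using assms by (auto simp: event_brick_wall event_brick_floor)
  then have "side (leg i) * reach (leg i) = 18 + advance r - advance (Suc r)"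
    using * assms by (simp add: event_brick_wall event_brick_floor_Suc side_cancel)
  then show False using reach_bounds[OF assms(1)] floor_offset[of r] by linarith
qed

lemma roof_neq_floor: "event_brick r 17 \<noteq> event_brick r' 24"
proof
  assume *: "event_brick r 17 = event_brick r' 24"
  then have "r' = Suc (Suc r)" by (auto simp: event_brick_roof event_brick_floor)
  with * have "entry (Suc r) = entry (Suc r) + side (Suc r) * (18 + advance (Suc r) - advance (Suc (Suc r)))"
    by (simp only: event_brick_roof event_brick_floor_Suc prod.inject)
  then have "18 + advance (Suc r) - advance (Suc (Suc r)) = 0" by (metis side_cancel_0)
  then show False using floor_offset[of "Suc r"] by linarith
qed

lemma event_brick_inj:
  assumes "event_brick r i = event_brick r' i'" "i \<le> 30" "i' \<le> 30"
  shows "r = r' \<and> i = i'"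
proof -
  consider "i = 17" "i' = 17" | "i = 24" "i' = 24" | "i \<noteq> 17" "i \<noteq> 24" "i' \<noteq> 17" "i' \<noteq> 24"
    using assms wall_neq_roof[of i r r'] wall_neq_roof[of i' r' r] wall_neq_floor[of i r r'] wall_neq_floor[of i' r' r]
      roof_neq_floor[of r r'] roof_neq_floor[of r' r] by metis
  then show ?thesis
  proof cases
    case 3
    then have r: "r = r'" using assms(1) by (simp add: event_brick_wall)
    then have "leg i = leg i'" using assms(1) 3 by (auto simp: event_brick_wall side_cancel dest: side_reach_inj)
    then have "i = i'" using 3 by (auto simp: leg_def split: if_splits)
    then show ?thesis using r by simp
  qed (use assms(1) in \<open>auto simp: event_brick_roof event_brick_floor\<close>)
qed

lemma event_brick_not_hole:
  assumes "i \<le> 30"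
  shows "event_brick r i \<noteq> (-1, 0)"
proof
  assume *: "event_brick r i = (-1, 0)"
  consider "i = 17" | "i = 24" | "i \<noteq> 17" "i \<noteq> 24" by blast
  then show False
  proof cases
    case 1
    then show ?thesis using * by (simp add: event_brick_roof)
  next
    case 2
    then have "r = Suc 0" using * by (auto simp: event_brick_floor)
    then show ?thesis using * 2 floor_offset[of 0] by (simp add: event_brick_floor_Suc)
  next
    case 3
    then have "r = 0" using * by (auto simp: event_brick_wall)
    then have "side (leg i) * reach (leg i) = 0" using * 3 by (simp add: event_brick_wall)
    then show ?thesis using reach_bounds[OF assms] by linarith
  qed
qed

section \<open>The rules of the game hold\<close>

lemma orbit_brick: "brick (orbit n) = event_brick (n div 31) (n mod 31)"
  by (simp add: orbit_def event_def)

lemma mod_31_le: "n mod 31 \<le> (30::nat)"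
  using mod_less_divisor[of 31 n] by linarith

lemma inj_orbit_brick: "brick (orbit n) = brick (orbit k) \<Longrightarrow> n = k"
  using event_brick_inj[of "n div 31" "n mod 31" "k div 31" "k mod 31"] mod_31_le[of n] mod_31_le[of k]
  by (metis orbit_brick div_mult_mod_eq)

lemma orbit_brick_present: "brick (orbit (Suc n)) \<in> bricks_after orbit n"
proof -
  have "brick (orbit (Suc n)) \<noteq> brick (orbit k)" if "k \<le> n" for k
    using inj_orbit_brick[of "Suc n" k] that by auto
  moreover have "brick (orbit (Suc n)) \<noteq> (-1, 0)"
    unfolding orbit_brick by (rule event_brick_not_hole[OF mod_31_le])
  ultimately show ?thesis by (auto simp: bricks_after_def initial_bricks_def)
qed

lemma event_brick_gone:
  assumes "31 * r + i \<le> n" "i \<le> 30"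
  shows "event_brick r i \<notin> bricks_after orbit n"
proof -
  have "brick (orbit (31 * r + i)) = event_brick r i" using assms(2) by (simp add: orbit_event event_def)
  then have "event_brick r i \<in> (\<lambda>k. brick (orbit k)) ` {..n}"
    using assms(1) by (metis atMost_iff imageI)
  then show ?thesis by (simp add: bricks_after_def)
qed

lemma entry_gone:
  assumes "31 * r \<le> n"
  shows "(entry r, int r) \<notin> bricks_after orbit n"
proof (cases r)
  case 0
  then show ?thesis by (simp add: bricks_after_def initial_bricks_def)
next
  case (Suc r')
  then show ?thesis using event_brick_gone[of r' 17 n] assms by (simp add: event_brick_roof del: entry.simps)
qed

lemma dug_cell_gone:
  assumes "J \<le> 28" "31 * r + slot J \<le> n"
    and "- int (Suc J div 2) \<le> side J * w" "side J * w \<le> reach J"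
  shows "(entry r + side r * w, int r) \<notin> bricks_after orbit n"
  using dug_offset_cases[OF assms(3,4)]
proof (elim disjE exE conjE)
  assume "w = 0"
  then show ?thesis using entry_gone[of r n] assms(2) by simp
next
  fix j assume j: "j \<le> J" "w = side j * reach j"
  then have "j \<le> 28" using assms(1) by simp
  note s = slot_facts[OF this]
  have "event_brick r (slot j) = (entry r + side r * w, int r)" using s j by (simp add: event_brick_wall)
  moreover have "31 * r + slot j \<le> n" using assms(2) slot_mono[OF j(1)] by simp
  ultimately show ?thesis using event_brick_gone[of r "slot j" n] s(1) by simp
qed

text \<open>On a vertical grid line, the ball separates two cells of the tunnel in its current row. The only
  horizontal grid line that it crosses without an impact is the one between two rows, through the
  roof hole; any other crossing within a leg is excluded by the phase.\<close>

lemma path_clear: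
  assumes i: "i \<le> 30" and n: "n = 31 * r + i"
    and X: "event_time r i < X" "X < next_time r i"
    and c: "c \<in> bricks_after orbit n"
  shows "position r i X \<notin> edges c"
proof
  let ?J = "leg i"
  have J: "?J \<le> 28" "31 * r + slot ?J \<le> n" using i n slot_leg_le[of i] by (auto simp: leg_def)
  assume "position r i X \<in> edges c"
  then have e: "(abscissa r ?J X, ordinate r (phase i) X) \<in> edges c" by (simp add: position_def)
  have X0: "0 \<le> X"
  proof -
    have "0 \<le> real_of_int (start r + tri ?J)" using start_nonneg[of r] tri_nonneg[of ?J] by linarith
    then show ?thesis using leg_window(1)[OF i, of r] X(1) by linarith
  qed
  have low: "level_time (3 * r + phase i) < X" using phase_window(1)[OF i, of r] X(1) by simp
  from edges_meet_grid_line[OF e] show False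
  proof
    assume "abscissa r ?J X \<in> \<int>"
    then obtain k where k: "X = of_int k" unfolding abscissa_Ints_iff by (auto elim: Ints_cases)
    have up: "X < level_time (3 * r + phase i + 1)"
    proof (cases "i = 30")
      case True
      have "X < of_int (start (Suc r))" using X(2) True by (simp add: next_time_def event_time_def leg_def)
      then have "k \<le> start r + 413 - advance r" using k by (simp add: start_Suc)
      then have "X \<le> of_int (start r) + 413 - of_int (advance r)" using k by linarith
      moreover have "level_time (3 * r + phase i + 1) = level_time (3 * r + 3)" using True by (simp add: phase_def numeral_3_eq_3)
      ultimately show ?thesis using passage_time[of r] by simp
    next
      case False
      then show ?thesis using phase_window(2)[OF i, of r] X(2) i by simp
    qed
    note y = ordinate_in_row[OF phase_le_2 low up]
    define s where "s = k - start r - tri ?J"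
    have "of_int (start r + tri ?J) < real_of_int k" "real_of_int k < of_int (start r + tri (Suc ?J))"
      using leg_window[OF i, of r] X unfolding k by linarith+
    then have s: "1 \<le> s" "s \<le> int ?J" by (simp_all add: s_def)
    (* offsets between the brick hit last and the opposite end of the tunnel *)
    have gone: "(entry r + side r * (side ?J * (reach ?J - t)), int r) \<notin> bricks_after orbit n"
      if "1 \<le> t" "t \<le> int ?J + 1" for t
    proof (rule dug_cell_gone[OF J])
      have *: "side ?J * (side ?J * (reach ?J - t)) = reach ?J - t" by (simp flip: mult.assoc)
      have "reach ?J + int (Suc ?J div 2) = int ?J + 1" unfolding reach_def by linarith
      then show "- int (Suc ?J div 2) \<le> side ?J * (side ?J * (reach ?J - t))" using that unfolding * by linarith
      show "side ?J * (side ?J * (reach ?J - t)) \<le> reach ?J" using that unfolding * by linarith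
    qed
    have "X = of_int (start r + tri ?J + s)" by (simp add: k s_def)
    then obtain x where x: "abscissa r ?J X = of_int x"
      and cells: "x = entry r + side r * (side ?J * (reach ?J - s)) \<and>
          x - 1 = entry r + side r * (side ?J * (reach ?J - (s + 1)))
        \<or> x - 1 = entry r + side r * (side ?J * (reach ?J - s)) \<and>
          x = entry r + side r * (side ?J * (reach ?J - (s + 1)))"
      using abscissa_on_grid[of r ?J s] by metis
    have "c = (x, int r) \<or> c = (x - 1, int r)"
      using vertical_line_edges[of x _ c "int r"] e y unfolding x by simp
    then have "c = (entry r + side r * (side ?J * (reach ?J - s)), int r)
        \<or> c = (entry r + side r * (side ?J * (reach ?J - (s + 1))), int r)"
      using cells by metis
    then show False using gone[of s] gone[of "s + 1"] s c by auto
  next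
    assume "ordinate r (phase i) X \<in> \<int>"
    then obtain l where l: "X = level_time l" using ordinate_Ints X0 by blast
    (* the crossing number l lies strictly beyond that of the current phase, so only the exit remains *)
    have l_low: "3 * r + phase i < l" using low unfolding l level_time_less_iff .
    have i30: "i = 30"
    proof (rule ccontr)
      assume "i \<noteq> 30"
      then have "level_time l < level_time (3 * r + phase i + 1)"
        using phase_window(2)[OF i, of r] X(2) i unfolding l by simp
      then show False using l_low unfolding level_time_less_iff by simp
    qed
    have "level_time l < level_time (3 * Suc r + 1)"
    proof -
      have "X < of_int (start (Suc r))" using X(2) i30 by (simp add: next_time_def event_time_def leg_def)
      also have "\<dots> < event_time (Suc r) 17" using event_time_17(1)[of "Suc r"] advance_bounds[of "Suc r"] by linarith
      finally show ?thesis unfolding l event_time_def by simp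
    qed
    then have "l < 3 * Suc r + 1" unfolding level_time_less_iff .
    then have l3: "l = 3 * r + 3" using l_low i30 by (simp add: phase_def)
    have o: "ordinate r (phase i) X = of_int (int r + 1)"
      by (simp add: ordinate_def i30 phase_def l l3 height_level_time)
    have j: "?J = 28" by (simp add: i30 leg_def)
    have "c = (entry (Suc r), int r + 1) \<or> c = (entry (Suc r), int r)"
    proof -
      have "X = level_time (3 * r + 3)" using l l3 by simp
      then show ?thesis
        using horizontal_line_edges[OF e[unfolded o j], of "entry (Suc r)"] passage_column[of r]
        by (simp del: entry.simps)
    qed
    moreover have "(entry (Suc r), int r + 1) \<notin> bricks_after orbit n"
      using event_brick_gone[of r 17 n] n i30 by (simp add: event_brick_roof add.commute del: entry.simps)
    moreover have "(entry r + side r * (7 + advance r), int r) \<notin> bricks_after orbit n"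
      by (rule dug_cell_gone[of 28]) (use advance_cases[of r] n i30 in \<open>auto simp: slot_def side_values reach_values\<close>)
    ultimately show False using c by auto
  qed
qed

lemma orbit_0: "orbit 0 = \<lparr>brick = (0, 0), site = (0, launch), incoming = (1, slope)\<rparr>"
  by (simp add: orbit_def event_def event_brick_def position_def abscissa_def ordinate_def velocity_def
      event_time_def leg_def phase_def reach_def start_0 height_def)

lemma symbolic_orbit_orbit:
  fixes n :: nat
  shows "symbolic_orbit orbit n = (if n mod 31 = 17 \<or> n mod 31 = 24 then Letter_a else Letter_b)"
  by (simp add: symbolic_orbit_def orbit_def hits_horizontal_event[OF mod_31_le])

lemma breakout_orbit_orbit: "breakout_orbit slope launch orbit"
  unfolding breakout_orbit_def
proof (intro conjI allI)
  fix n :: nat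
  define r where "r = n div 31"
  define i where "i = n mod 31"
  have i: "i \<le> 30" by (simp add: i_def mod_31_le)
  have n: "n = 31 * r + i" by (simp add: r_def i_def)
  have now: "orbit n = event r i" by (simp add: orbit_def r_def i_def)
  have nxt: "orbit (Suc n) = next_event r i" by (simp add: orbit_Suc r_def i_def)
  show "incoming (orbit (Suc n)) = outgoing (orbit n)"
    by (simp add: now nxt next_event_incoming[OF i] outgoing_event[OF i])
  show "brick (orbit (Suc n)) \<in> bricks_after orbit n" by (rule orbit_brick_present)
  show "site (orbit (Suc n)) \<in> edges (brick (orbit (Suc n)))"
    unfolding orbit_def by (rule site_event_edges[OF mod_31_le])
  let ?t = "next_time r i - event_time r i"
  have start: "0 \<le> event_time r i"
  proof -
    have "0 \<le> real_of_int (start r + tri (leg i))" using start_nonneg[of r] tri_nonneg[of "leg i"] by linarith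
    then show ?thesis using leg_window(1)[OF i, of r] by linarith
  qed
  have "site (orbit n) = position r i (event_time r i)" by (simp add: now event_def)
  moreover have "outgoing (orbit n) = velocity r i" by (simp only: now outgoing_event[OF i])
  ultimately have along: "site (orbit n) + s *\<^sub>R outgoing (orbit n) = position r i (event_time r i + s)" for s
    by (simp add: position_along)
  show "\<exists>t>0. site (orbit (Suc n)) = site (orbit n) + t *\<^sub>R outgoing (orbit n) \<and>
      (\<forall>s. 0 < s \<and> s < t \<longrightarrow> (\<forall>c\<in>bricks_after orbit n. site (orbit n) + s *\<^sub>R outgoing (orbit n) \<notin> edges c)) \<and>
      (\<forall>s. 0 \<le> s \<and> s \<le> t \<longrightarrow> site (orbit n) + s *\<^sub>R outgoing (orbit n) \<notin> \<int> \<times> \<int>)"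
    unfolding along
  proof (intro exI[of _ ?t] conjI allI impI ballI)
    show "0 < ?t" using event_time_less_next[OF i, of r] by simp
    show "site (orbit (Suc n)) = position r i (event_time r i + ?t)" by (simp add: nxt next_event_site[OF i])
    fix s
    { fix c assume "0 < s \<and> s < ?t" "c \<in> bricks_after orbit n"
      then show "position r i (event_time r i + s) \<notin> edges c" by (intro path_clear[OF i n]) auto }
    { assume "0 \<le> s \<and> s \<le> ?t"
      then show "position r i (event_time r i + s) \<notin> \<int> \<times> \<int>" using start by (intro position_not_lattice) auto }
  qed
qed (use slope_bounds launch_bounds in \<open>simp_all add: orbit_0\<close>)

end

theorem proposition4p2:
  "\<exists>\<omega> :: nat \<Rightarrow> letter.
     infinite {S :: real. 0 < S \<and> S < 1 \<and>
       (\<exists>y\<^sub>0 h. breakout_orbit S y\<^sub>0 h \<and> symbolic_orbit h = \<omega>)}"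
proof
  let ?\<omega> = "\<lambda>n :: nat. if n mod 31 = 17 \<or> n mod 31 = 24 then Letter_a else Letter_b"
  let ?A = "{S :: real. 0 < S \<and> S < 1 \<and> (\<exists>y\<^sub>0 h. breakout_orbit S y\<^sub>0 h \<and> symbolic_orbit h = ?\<omega>)}"
  have "slope_family.slope (Suc k) \<in> ?A" for k
  proof -
    interpret slope_family "Suc k" by unfold_locales simp
    have "symbolic_orbit orbit = ?\<omega>" by (rule ext) (rule symbolic_orbit_orbit)
    then show ?thesis using breakout_orbit_orbit slope_bounds by blast
  qed
  then have "range (\<lambda>k. slope_family.slope (Suc k)) \<subseteq> ?A" by blast
  moreover have "inj (\<lambda>k. slope_family.slope (Suc k))"
  proof (rule injI)
    fix k l assume eq: "slope_family.slope (Suc k) = slope_family.slope (Suc l)"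
    have "slope_family (Suc k)" "slope_family (Suc l)" by unfold_locales simp_all
    note eq[unfolded slope_family.slope_def[OF this(1)] slope_family.slope_def[OF this(2)]]
    moreover have nonzero: "414 * real (Suc k) - 1 \<noteq> 0" "414 * real (Suc l) - 1 \<noteq> 0" by simp_all
    ultimately have "3 * real (Suc k) * (414 * real (Suc l) - 1) = 3 * real (Suc l) * (414 * real (Suc k) - 1)"
      using frac_eq_eq[OF nonzero] by blast
    then show "k = l" by (simp add: algebra_simps)
  qed
  then have "infinite (range (\<lambda>k. slope_family.slope (Suc k)))" by (simp add: finite_image_iff)
  ultimately show "infinite ?A" using infinite_super by blast
qed

end
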